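(* Let $wt(6,2)=\limsup_{n\to\infty}\frac{\log_2 WM(n,6,2)}{n}$, where $WM(n,6,2)$ is the maximum cardinality of a $6$-locally $2$-thin family of subsets of $[n]$. Then $wt(6,2)>0.2522$.
   Context: $[n]=\{1,2,\ldots,n\}$. A family $\mathcal{F}$ of subsets of $[n]$ is called $k$-locally $2$-thin if, for any $k$ distinct members of $\mathcal{F}$, there exists at least one point of $[n]$ that is contained in exactly $1$ or exactly $2$ of these $k$ members. $WM(n,k,2)$ denotes the maximum cardinality of a $k$-locally $2$-thin family of subsets of $[n]$. *)

theory Defs
  imports "HOL-Analysis.Analysis"
begin

definition locally_2_thin :: "nat \<Rightarrow> nat \<Rightarrow> nat set set \<Rightarrow> bool" where
  "locally_2_thin n k F \<longleftrightarrow>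
     F \<subseteq> Pow {1..n} \<and>
     (\<forall>G. G \<subseteq> F \<and> card G = k \<longrightarrow>
        (\<exists>x\<in>{1..n}. card {A \<in> G. x \<in> A} = 1 \<or> card {A \<in> G. x \<in> A} = 2))"

definition WM2 :: "nat \<Rightarrow> nat \<Rightarrow> nat" where
  "WM2 n k = Max {card F | F. locally_2_thin n k F}"

text \<open>The maximum is over a finite set, which is nonempty for \<open>k > 0\<close>.\<close>

lemma finite_card_locally_2_thin: "finite {card F | F. locally_2_thin n k F}"
proof -
  have "{card F | F. locally_2_thin n k F} \<subseteq> card ` Pow (Pow {1..n})"
    by (auto simp: locally_2_thin_def)
  then show ?thesis
    by (rule finite_subset) simp
qed

lemma locally_2_thin_empty: "k > 0 \<Longrightarrow> locally_2_thin n k {}"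
  by (auto simp: locally_2_thin_def)

text \<open>The limit superior is taken in the extended reals, so that it is the genuine one
  without any boundedness side condition. The junk value at \<open>n = 0\<close> does not affect it.\<close>

definition wt2 :: "nat \<Rightarrow> ereal" where
  "wt2 k = limsup (\<lambda>n. ereal (log 2 (real (WM2 n k)) / real n))"

end

theory Submission
  imports Defs "HOL-Probability.Product_PMF" "HOL-Real_Asymp.Real_Asymp"
begin

text \<open>
  The bound comes from a random construction with deletions. Take \<open>N\<close> random subsets of
  \<open>{1..n}\<close>, every point belonging to every subset independently with probability \<open>p\<close>. Among
  \<open>k\<close> of these sets, the number that contain a given point is binomially distributed, so it
  is neither \<open>1\<close> nor \<open>2\<close> with probability
  \<open>q = 1 - k p (1 - p)^(k-1) - (k choose 2) p^2 (1 - p)^(k-2)\<close>, and by independence of the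
  points the \<open>k\<close> sets violate the condition with probability \<open>q^n\<close>. Hence some outcome has at
  most \<open>(N choose k) q^n\<close> violating \<open>k\<close>-sets of indices (\<open>few_bad_subsets\<close>). Deleting one
  index from each of them leaves an indexed family in which any \<open>k\<close> distinct indices satisfy
  the condition (\<open>deletion\<close>).

  Different indices may carry the same set, but the condition itself limits such repetitions:
  \<open>k\<close> equal sets contain every point either \<open>0\<close> or \<open>k\<close> times, so for
  \<open>k \<ge> 3\<close> the surviving indices repeat each set at most \<open>k - 1\<close> times
  (\<open>card_index_le_WM2\<close>).

  For \<open>k = 6\<close> and \<open>p = 1/4\<close> one gets \<open>q = 1423/4096\<close>, and \<open>N\<close> may be as large as about
  \<open>q^(-n/5)\<close>, that is, about \<open>2^(0.305 n)\<close>. The proof uses the rounder rate \<open>0.3\<close>, for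
  which \<open>(2^0.3)^5 q = 2^1.5 q \<le> 1\<close>.
\<close>

section \<open>Indexed families\<close>

text \<open>
  A family of sets indexed by \<open>i\<close> is given by its incidence relation \<open>X\<close>, where \<open>X x i\<close>
  means that the point \<open>x\<close> lies in the \<open>i\<close>-th set. The points come first because the
  random incidence relation is independent over the points; \<open>c\<close> below is one row \<open>X x\<close>.
\<close>

definition hit_once_or_twice :: "('i \<Rightarrow> bool) \<Rightarrow> 'i set \<Rightarrow> bool" where
  "hit_once_or_twice c I \<longleftrightarrow> card {i \<in> I. c i} = 1 \<or> card {i \<in> I. c i} = 2"

lemma card_le_WM2: "locally_2_thin n k F \<Longrightarrow> card F \<le> WM2 n k"
  unfolding WM2_def using finite_card_locally_2_thin by (intro Max_ge) auto

text \<open>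
  The factor \<open>k - 1\<close> pays for repetitions: \<open>k\<close> indices of the same set would be hit \<open>0\<close> or
  \<open>k\<close> times by every point, and \<open>k \<ge> 3\<close> excludes both numbers.
\<close>

lemma card_index_le_WM2:
  fixes X :: "nat \<Rightarrow> 'i \<Rightarrow> bool"
  assumes k: "k \<ge> 3" and J: "finite J"
    and good: "\<And>I. I \<subseteq> J \<Longrightarrow> card I = k \<Longrightarrow> \<exists>x\<in>{1..n}. hit_once_or_twice (X x) I"
  shows "card J \<le> (k - 1) * WM2 n k"
proof -
  define S where "S = (\<lambda>i. {x \<in> {1..n}. X x i})"
  have thin: "locally_2_thin n k (S ` J)"
    unfolding locally_2_thin_def
  proof (intro conjI allI impI)
    show "S ` J \<subseteq> Pow {1..n}"
      by (auto simp: S_def)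
  next
    fix G assume G: "G \<subseteq> S ` J \<and> card G = k"
    then obtain I where I: "I \<subseteq> J" "inj_on S I" "G = S ` I"
      by (auto simp: subset_image_inj)
    with G have "card I = k"
      by (simp add: card_image)
    with good I obtain x where x: "x \<in> {1..n}" "hit_once_or_twice (X x) I"
      by blast
    have "{A \<in> G. x \<in> A} = S ` {i \<in> I. X x i}"
      using I x by (auto simp: S_def)
    moreover have "inj_on S {i \<in> I. X x i}"
      using I(2) by (rule inj_on_subset) auto
    ultimately have "card {A \<in> G. x \<in> A} = card {i \<in> I. X x i}"
      by (simp add: card_image)
    with x show "\<exists>x\<in>{1..n}. card {A \<in> G. x \<in> A} = 1 \<or> card {A \<in> G. x \<in> A} = 2"
      by (auto simp: hit_once_or_twice_def intro!: bexI[of _ x])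
  qed
  have fibre: "card {i \<in> J. S i = A} \<le> k - 1" for A
  proof (rule ccontr)
    assume "\<not> ?thesis"
    then have "k \<le> card {i \<in> J. S i = A}"
      by simp
    then obtain I where I: "I \<subseteq> {i \<in> J. S i = A}" "card I = k"
      by (meson obtain_subset_with_card_n)
    then obtain x where x: "x \<in> {1..n}" "hit_once_or_twice (X x) I"
      using good[of I] by blast
    have "X x i \<longleftrightarrow> x \<in> A" if "i \<in> I" for i
      using I that x by (auto simp: S_def)
    then have "{i \<in> I. X x i} = (if x \<in> A then I else {})"
      by auto
    with x I k show False
      by (auto simp: hit_once_or_twice_def split: if_splits)
  qed
  have "J = (\<Union>A\<in>S ` J. {i \<in> J. S i = A})"
    by auto
  then have "card J \<le> (\<Sum>A\<in>S ` J. card {i \<in> J. S i = A})"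
    using card_UN_le[of "S ` J" "\<lambda>A. {i \<in> J. S i = A}"] J by simp
  also have "\<dots> \<le> (\<Sum>A\<in>S ` J. k - 1)"
    by (intro sum_mono fibre)
  also have "\<dots> = (k - 1) * card (S ` J)"
    by simp
  also have "\<dots> \<le> (k - 1) * WM2 n k"
    by (intro mult_left_mono card_le_WM2 thin) simp
  finally show ?thesis .
qed

lemma deletion:
  assumes U: "finite U" and B: "finite B" and nonempty: "{} \<notin> B"
  obtains J where "J \<subseteq> U" "card U \<le> card J + card B" "\<And>I. I \<in> B \<Longrightarrow> \<not> I \<subseteq> J"
proof
  define D where "D = (\<lambda>I. SOME i. i \<in> I) ` B"
  show "U - D \<subseteq> U"
    by auto
  have "card U - card D \<le> card (U - D)"
    by (intro diff_card_le_card_Diff) (simp add: D_def B)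
  moreover have "card D \<le> card B"
    unfolding D_def by (intro card_image_le B)
  ultimately show "card U \<le> card (U - D) + card B"
    by linarith
  show "\<not> I \<subseteq> U - D" if "I \<in> B" for I
  proof -
    have "(SOME i. i \<in> I) \<in> I"
      using that nonempty by (metis some_in_eq)
    then show ?thesis
      using that by (auto simp: D_def)
  qed
qed

section \<open>The random family\<close>

definition miss_prob :: "nat \<Rightarrow> real \<Rightarrow> real" where
  "miss_prob k p = 1 - (real k * p * (1 - p) ^ (k - 1) + real (k choose 2) * p\<^sup>2 * (1 - p) ^ (k - 2))"

definition random_row :: "'i set \<Rightarrow> real \<Rightarrow> ('i \<Rightarrow> bool) pmf" where
  "random_row U p = Pi_pmf U False (\<lambda>_. bernoulli_pmf p)"

definition random_incidence :: "nat \<Rightarrow> 'i set \<Rightarrow> real \<Rightarrow> (nat \<Rightarrow> 'i \<Rightarrow> bool) pmf" where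
  "random_incidence n U p = Pi_pmf {1..n} (\<lambda>_. False) (\<lambda>_. random_row U p)"

lemma prob_row_miss:
  assumes U: "finite U" and I: "I \<subseteq> U" "card I = k" and p: "p \<in> {0..1}"
  shows "measure_pmf.prob (random_row U p) {c. \<not> hit_once_or_twice c I} = miss_prob k p"
proof -
  have finI: "finite I"
    using U I finite_subset by blast
  have "binomial_pmf k p = map_pmf (\<lambda>c. card {i \<in> I. c i}) (Pi_pmf I False (\<lambda>_. bernoulli_pmf p))"
    by (intro binomial_pmf_altdef' finI I p)
  also have "Pi_pmf I False (\<lambda>_. bernoulli_pmf p)
      = map_pmf (\<lambda>c i. if i \<in> I then c i else False) (random_row U p)"
    unfolding random_row_def by (intro Pi_pmf_subset U I)
  also have "map_pmf (\<lambda>c. card {i \<in> I. c i}) \<dots> = map_pmf (\<lambda>c. card {i \<in> I. c i}) (random_row U p)"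
    by (simp add: map_pmf_comp cong: conj_cong)
  finally have binom: "binomial_pmf k p = map_pmf (\<lambda>c. card {i \<in> I. c i}) (random_row U p)" .
  have "measure_pmf.prob (random_row U p) {c. hit_once_or_twice c I}
      = measure_pmf.prob (binomial_pmf k p) {1, 2}"
    unfolding binom by (simp add: hit_once_or_twice_def vimage_def)
  also have "\<dots> = 1 - miss_prob k p"
    using p by (simp add: measure_measure_pmf_finite miss_prob_def)
  finally have "measure_pmf.prob (random_row U p) {c. hit_once_or_twice c I} = 1 - miss_prob k p" .
  moreover have "{c. \<not> hit_once_or_twice c I} = UNIV - {c. hit_once_or_twice c I}"
    by auto
  ultimately show ?thesis
    using measure_pmf.prob_compl[of "{c. hit_once_or_twice c I}" "random_row U p"] by simp
qed

lemma prob_incidence_miss: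
  assumes "finite U" "I \<subseteq> U" "card I = k" "p \<in> {0..1}"
  shows "measure_pmf.prob (random_incidence n U p) {X. \<forall>x\<in>{1..n}. \<not> hit_once_or_twice (X x) I}
    = miss_prob k p ^ n"
proof -
  have "{X. \<forall>x\<in>{1..n}. \<not> hit_once_or_twice (X x) I} = Pi {1..n} (\<lambda>_. {c. \<not> hit_once_or_twice c I})"
    by (auto simp: Pi_def)
  then show ?thesis
    using prob_row_miss[OF assms] by (simp add: random_incidence_def measure_Pi_pmf_Pi)
qed

text \<open>
  First moment method: the number of violating \<open>k\<close>-sets cannot exceed its expectation in every
  outcome, and by linearity the expectation is the bound stated here.
\<close>

lemma few_bad_subsets:
  fixes U :: "'i set"
  assumes U: "finite U" and p: "p \<in> {0..1}"
  obtains X :: "nat \<Rightarrow> 'i \<Rightarrow> bool" where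
    "real (card {I. I \<subseteq> U \<and> card I = k \<and> (\<forall>x\<in>{1..n}. \<not> hit_once_or_twice (X x) I)})
       \<le> real (card U choose k) * miss_prob k p ^ n"
proof (rule ccontr)
  note result = that
  define K where "K = {I. I \<subseteq> U \<and> card I = k}"
  define bad where "bad = (\<lambda>I. {X :: nat \<Rightarrow> 'i \<Rightarrow> bool. \<forall>x\<in>{1..n}. \<not> hit_once_or_twice (X x) I})"
  let ?M = "random_incidence n U p" and ?b = "real (card U choose k) * miss_prob k p ^ n"
  assume no: "\<not> thesis"
  have finK: "finite K"
    using U by (auto simp: K_def)
  have count: "real (card {I. I \<subseteq> U \<and> card I = k \<and> (\<forall>x\<in>{1..n}. \<not> hit_once_or_twice (X x) I)})
      = (\<Sum>I\<in>K. indicator (bad I) X)" for X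
  proof -
    have "{I. I \<subseteq> U \<and> card I = k \<and> (\<forall>x\<in>{1..n}. \<not> hit_once_or_twice (X x) I)}
        = {I \<in> K. X \<in> bad I}"
      by (auto simp: K_def bad_def)
    then show ?thesis
      using finK by (simp add: indicator_def sum.If_cases Int_def)
  qed
  have int: "integrable ?M (indicat_real (bad I))" for I
    by (intro integrable_real_indicator) (auto simp: measure_pmf.emeasure_eq_measure)
  have "?b < (\<Sum>I\<in>K. indicator (bad I) X)" for X
    using result[of X] no unfolding count by force
  then have "?b < measure_pmf.expectation ?M (\<lambda>X. \<Sum>I\<in>K. indicator (bad I) X)"
    by (intro measure_pmf.expectation_greater) (auto intro: int)
  also have "\<dots> = (\<Sum>I\<in>K. measure_pmf.prob ?M (bad I))"
    by (subst Bochner_Integration.integral_sum) (auto intro: int)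
  also have "\<dots> = (\<Sum>I\<in>K. miss_prob k p ^ n)"
    unfolding bad_def by (intro sum.cong refl prob_incidence_miss U p) (auto simp: K_def)
  also have "\<dots> = ?b"
    using n_subsets[OF U, of k] by (simp add: K_def)
  finally show False
    by simp
qed

theorem WM2_lower_bound:
  assumes k: "k \<ge> 3" and p: "p \<in> {0..1}"
  shows "real N - real (N choose k) * miss_prob k p ^ n \<le> real (k - 1) * real (WM2 n k)"
proof -
  obtain X :: "nat \<Rightarrow> nat \<Rightarrow> bool" where X:
    "real (card {I. I \<subseteq> {..<N} \<and> card I = k \<and> (\<forall>x\<in>{1..n}. \<not> hit_once_or_twice (X x) I)})
       \<le> real (card {..<N} choose k) * miss_prob k p ^ n"
    using few_bad_subsets[of "{..<N}" p k n] p by blast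
  define B where
    "B = {I. I \<subseteq> {..<N} \<and> card I = k \<and> (\<forall>x\<in>{1..n}. \<not> hit_once_or_twice (X x) I)}"
  have "finite B"
    by (auto simp: B_def)
  moreover have "{} \<notin> B"
    using k by (auto simp: B_def)
  ultimately obtain J where J: "J \<subseteq> {..<N}" "card {..<N} \<le> card J + card B"
      "\<And>I. I \<in> B \<Longrightarrow> \<not> I \<subseteq> J"
    using deletion[of "{..<N}" B] by blast
  have "\<exists>x\<in>{1..n}. hit_once_or_twice (X x) I" if "I \<subseteq> J" "card I = k" for I
    using that J(1) J(3)[of I] by (auto simp: B_def)
  moreover have "finite J"
    using J(1) finite_subset by blast
  ultimately have "card J \<le> (k - 1) * WM2 n k"
    using card_index_le_WM2[OF k] by blast
  then have "real (card J) \<le> real (k - 1) * real (WM2 n k)"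
    unfolding of_nat_mult[symmetric] of_nat_le_iff .
  moreover have "real N \<le> real (card J) + real (card B)"
    using J(2) by simp
  ultimately show ?thesis
    using X unfolding B_def[symmetric] by simp
qed

section \<open>Six sets\<close>

lemma miss_prob_6: "miss_prob 6 (1/4) = 1423 / 4096"
  by (simp add: miss_prob_def choose_two power_divide)

text \<open>
  The loss of a factor \<open>20\<close> consists of at most \<open>2\<close> for rounding \<open>N\<close> down, at most \<open>2\<close> for
  the deleted indices, which are at most half of all, and \<open>5 = k - 1\<close> for repeated sets.
\<close>

lemma WM2_6_lower_bound:
  assumes n: "n \<ge> 4"
  shows "real (WM2 n 6) \<ge> 2 powr (0.3 * real n) / 20"
proof -
  define y where "y = 2 powr (0.3 * real n)"
  define N where "N = nat \<lfloor>y\<rfloor>"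
  define q :: real where "q = 1423 / 4096"
  have "2 powr 1 \<le> y"
    unfolding y_def using n by (intro powr_mono) auto
  then have y: "y \<ge> 2"
    by simp
  have N: "real N \<le> y" "y - 1 \<le> real N"
    using y unfolding N_def by linarith+
  have "y ^ 5 = (2 powr 1.5) ^ n"
    by (simp add: y_def powr_power mult_ac)
  then have "y ^ 5 * q ^ n = (2 powr 1.5 * q) ^ n"
    by (simp add: power_mult_distrib)
  also have "\<dots> \<le> 1"
  proof (rule power_le_one)
    have "(2 powr 1.5) ^ 2 = (8 :: real)"
      by (simp add: powr_power)
    then have "(2 powr 1.5 * q) ^ 2 \<le> 1"
      by (simp add: power_mult_distrib q_def power_divide)
    then show "2 powr 1.5 * q \<le> 1"
      by (simp add: power_le_one_iff q_def abs_square_le_1)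
  qed (simp add: q_def)
  finally have yq: "y ^ 5 * q ^ n \<le> 1" .
  have "real (N choose 6) * 720 \<le> real N ^ 6"
    using binomial_fact_pow[of N 6] by (simp add: fact_numeral flip: of_nat_power)
  then have "real (N choose 6) * 720 * q ^ n \<le> real N ^ 6 * q ^ n"
    by (intro mult_right_mono) (auto simp: q_def)
  also have "\<dots> = real N * (real N ^ 5 * q ^ n)"
    by (simp add: power_numeral_reduce)
  also have "\<dots> \<le> real N * (y ^ 5 * q ^ n)"
    using N by (intro mult_left_mono mult_right_mono power_mono) (auto simp: q_def)
  also have "\<dots> \<le> real N * 1"
    using yq by (intro mult_left_mono) auto
  finally have "real (N choose 6) * q ^ n \<le> real N / 2"
    by simp
  moreover have "real N - real (N choose 6) * q ^ n \<le> 5 * real (WM2 n 6)"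
    using WM2_lower_bound[of 6 "1/4" N n] by (simp add: miss_prob_6 q_def)
  ultimately have "y / 20 \<le> real (WM2 n 6)"
    using N y by argo
  then show ?thesis
    by (simp add: y_def)
qed

theorem mainTheorem5:
  shows "wt2 6 > ereal 0.2522"
proof -
  have "eventually (\<lambda>n. 0.26 \<le> log 2 (2 powr (0.3 * real n) / 20) / real n) sequentially"
    by real_asymp
  then have "eventually (\<lambda>n. ereal 0.26 \<le> ereal (log 2 (real (WM2 n 6)) / real n)) sequentially"
    using eventually_ge_at_top[of 4]
  proof eventually_elim
    case (elim n)
    have "log 2 (2 powr (0.3 * real n) / 20) \<le> log 2 (real (WM2 n 6))"
      using WM2_6_lower_bound[OF elim(2)] by (intro log_mono) auto
    then have "log 2 (2 powr (0.3 * real n) / 20) / real n \<le> log 2 (real (WM2 n 6)) / real n"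
      by (rule divide_right_mono) simp
    with elim(1) show ?case
      unfolding ereal_less_eq by (rule order_trans)
  qed
  then have "ereal 0.26 \<le> wt2 6"
    unfolding wt2_def by (intro le_Limsup) auto
  moreover have "ereal 0.2522 < ereal 0.26"
    by simp
  ultimately show ?thesis
    by (rule less_le_trans[rotated])
qed

end
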